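(* Let $\mathcal{A}\in T_{m,n}$ be a row diagonal tensor of even order $m$. Then the following are equivalent: (a) $M(\mathcal{A})$ is a column competent matrix; (b) $\mathcal{A}$ is a column competent tensor; (c) for every $q\in\mathbb{R}^n$, the tensor complementarity problem TCP$(q,\mathcal{A})$ has a finite number (possibly zero) of $\omega$-solutions.
   Context: $T_{m,n}$ is the set of real tensors $\mathcal{A}=(a_{i_1 i_2\ldots i_m})$ of order $m$ and dimension $n$ (with $i_1,\ldots,i_m\in[n]=\{1,\ldots,n\}$, $m,n$ positive integers, $m\ge 2$). For $x\in\mathbb{R}^n$, $\mathcal{A}x^{m-1}\in\mathbb{R}^n$ is the vector with $(\mathcal{A}x^{m-1})_i=\sum_{i_2,\ldots,i_m=1}^n a_{i i_2\ldots i_m}x_{i_2}\cdots x_{i_m}$. A tensor $\mathcal{A}\in T_{m,n}$ is column competent if, for $x\in\mathbb{R}^n$, $x_i(\mathcal{A}x^{m-1})_i=0$ for all $i\in[n]$ implies $\mathcal{A}x^{m-1}=0$. A matrix $A\in\mathbb{R}^{n\times n}$ is column competent if, for $z\in\mathbb{R}^n$, $z_i(Az)_i=0$ for all $i$ implies $Az=0$. $\mathcal{A}$ is row diagonal if $a_{i i_2\ldots i_m}$ can be nonzero only when $i_2=\cdots=i_m$. The majorization matrix $M(\mathcal{A})$ is the $n\times n$ matrix with entries $M(\mathcal{A})_{ij}=a_{ijj\ldots j}$. For $q\in\mathbb{R}^n$, TCP$(q,\mathcal{A})$ is to find $x\in\mathbb{R}^n$ with $x\ge 0$, $\omega=\mathcal{A}x^{m-1}+q\ge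 0$ and $x^T\omega=0$ (inequalities componentwise); such a pair $(\omega,x)$ is a solution, and a vector $\omega$ is an $\omega$-solution if there exists $x$ such that $(\omega,x)$ is a solution. *)

theory Defs
  imports "HOL-Analysis.Analysis"
begin

text \<open>The dimension is the cardinality of the finite index type; a tensor of order \<open>m\<close> is
  given by its entries at index lists of length \<open>m\<close>. Values at lists of any other length carry
  no meaning, so every notion below takes the order as a parameter and reads only entries at
  lists of length \<open>m\<close> (for \<open>m \<ge> 1\<close>).\<close>

type_synonym 'n tensor = "'n list \<Rightarrow> real"

definition tensor_apply :: "nat \<Rightarrow> 'n::finite tensor \<Rightarrow> real ^ 'n \<Rightarrow> real ^ 'n" where
  "tensor_apply m A x =
     (\<chi> i. \<Sum>js | length js = m - 1. A (i # js) * (\<Prod>j\<leftarrow>js. x $ j))"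

definition column_competent_tensor :: "nat \<Rightarrow> 'n::finite tensor \<Rightarrow> bool" where
  "column_competent_tensor m A \<longleftrightarrow>
     (\<forall>x. (\<forall>i. x $ i * tensor_apply m A x $ i = 0) \<longrightarrow> tensor_apply m A x = 0)"

definition column_competent_matrix :: "real ^ 'n ^ 'n::finite \<Rightarrow> bool" where
  "column_competent_matrix B \<longleftrightarrow> (\<forall>z. (\<forall>i. z $ i * (B *v z) $ i = 0) \<longrightarrow> B *v z = 0)"

definition row_diagonal :: "nat \<Rightarrow> 'n::finite tensor \<Rightarrow> bool" where
  "row_diagonal m A \<longleftrightarrow>
     (\<forall>i js. length js = m - 1 \<and> A (i # js) \<noteq> 0 \<longrightarrow> (\<forall>j\<in>set js. \<forall>k\<in>set js. j = k))"

definition majorization_matrix :: "nat \<Rightarrow> 'n::finite tensor \<Rightarrow> real ^ 'n ^ 'n" where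
  "majorization_matrix m A = (\<chi> i j. A (i # replicate (m - 1) j))"

definition TCP_solution ::
    "nat \<Rightarrow> real ^ 'n \<Rightarrow> 'n::finite tensor \<Rightarrow> real ^ 'n \<Rightarrow> real ^ 'n \<Rightarrow> bool" where
  "TCP_solution m q A \<omega> x \<longleftrightarrow>
     (\<forall>i. 0 \<le> x $ i) \<and> \<omega> = tensor_apply m A x + q \<and> (\<forall>i. 0 \<le> \<omega> $ i) \<and> x \<bullet> \<omega> = 0"

definition omega_solutions ::
    "nat \<Rightarrow> real ^ 'n \<Rightarrow> 'n::finite tensor \<Rightarrow> (real ^ 'n) set" where
  "omega_solutions m q A = {\<omega>. \<exists>x. TCP_solution m q A \<omega> x}"

end

theory Submission imports Defs begin

text \<open>For a row diagonal tensor, \<open>\<A>x\<^sup>m\<^sup>-\<^sup>1 = M(\<A>) y\<close> where \<open>y\<close> is the componentwise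
  power \<open>y\<^sub>j = x\<^sub>j\<^sup>m\<^sup>-\<^sup>1\<close>. As \<open>m - 1\<close> is odd, \<open>x \<mapsto> y\<close> is a bijection preserving the zero
  pattern and the nonnegative orthant, so all three conditions become conditions on the matrix
  \<open>M = M(\<A>)\<close>, the third one about the linear complementarity problem.
  If \<open>M\<close> is column competent, a solution \<open>\<omega>\<close> is determined by its zero set: for two solutions with
  the same zero set, the difference \<open>d\<close> of the underlying \<open>y\<close>'s satisfies \<open>d\<^sub>i (M d)\<^sub>i = 0\<close>.
  Conversely, if \<open>z\<^sub>i (M z)\<^sub>i = 0\<close> for all \<open>i\<close> but \<open>M z \<noteq> 0\<close>, then \<open>\<bar>z\<bar> + t z\<close> with \<open>0 \<le> t \<le> 1\<close> are
  solutions for the vector \<open>q = \<bar>M z\<bar> - M \<bar>z\<bar>\<close>, with pairwise distinct \<open>\<omega> = \<bar>M z\<bar> + t M z\<close>.\<close>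

text \<open>Complementarity is stated entrywise, the form in which column competence can be applied;
  for nonnegative vectors it agrees with a vanishing inner product.\<close>

definition LCP_omega_solutions :: "real ^ 'n \<Rightarrow> real ^ 'n ^ 'n::finite \<Rightarrow> (real ^ 'n) set" where
  "LCP_omega_solutions q B =
     {w. \<exists>z. (\<forall>i. 0 \<le> z $ i) \<and> w = B *v z + q \<and> (\<forall>i. 0 \<le> w $ i) \<and> (\<forall>i. z $ i * w $ i = 0)}"

lemma finite_LCP_omega_solutions:
  fixes B :: "real ^ 'n ^ 'n::finite"
  assumes "column_competent_matrix B"
  shows "finite (LCP_omega_solutions q B)"
proof -
  have "inj_on (\<lambda>w. {i. w $ i = 0}) (LCP_omega_solutions q B)"
  proof (rule inj_onI)
    fix w w'
    assume "w \<in> LCP_omega_solutions q B" "w' \<in> LCP_omega_solutions q B"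
      and eq: "{i. w $ i = 0} = {i. w' $ i = 0}"
    then obtain z z' where z: "w = B *v z + q" "\<forall>i. z $ i * w $ i = 0"
      and z': "w' = B *v z' + q" "\<forall>i. z' $ i * w' $ i = 0"
      unfolding LCP_omega_solutions_def by blast
    have diff: "B *v (z - z') = w - w'"
      using z(1) z'(1) by (simp add: matrix_vector_mult_diff_distrib)
    \<comment> \<open>If \<open>w\<close> and \<open>w'\<close> vanish at \<open>i\<close>, so does
      the second factor; otherwise both are nonzero there, and complementarity gives
      \<open>z $ i = z' $ i = 0\<close>.\<close>
    have "(z - z') $ i * (B *v (z - z')) $ i = 0" for i
    proof -
      have "w $ i = 0 \<longleftrightarrow> w' $ i = 0"
        using eq by blast
      then show ?thesis
        unfolding diff using z(2)[rule_format, of i] z'(2)[rule_format, of i]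
        by (cases "w $ i = 0") auto
    qed
    then have "B *v (z - z') = 0"
      using assms unfolding column_competent_matrix_def by blast
    then show "w = w'"
      using diff by simp
  qed
  \<comment> \<open>The index type is finite, so there are only finitely many zero sets.\<close>
  then show ?thesis
    by (rule inj_on_finite[where B = UNIV]) auto
qed

lemma column_competent_matrix_if_finite_LCP_omega_solutions:
  fixes B :: "real ^ 'n ^ 'n::finite"
  assumes "\<And>q. finite (LCP_omega_solutions q B)"
  shows "column_competent_matrix B"
  unfolding column_competent_matrix_def
proof (intro allI impI, rule ccontr)
  fix z
  assume compl: "\<forall>i. z $ i * (B *v z) $ i = 0" and nz: "B *v z \<noteq> 0"
  define w where "w = B *v z"
  define z0 :: "real ^ 'n" where "z0 = (\<chi> i. \<bar>z $ i\<bar>)"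
  define w0 :: "real ^ 'n" where "w0 = (\<chi> i. \<bar>w $ i\<bar>)"
  \<comment> \<open>This \<open>q\<close> makes \<open>w0\<close> the image of \<open>z0\<close>, so
    adding \<open>t z\<close> to \<open>z0\<close> adds exactly \<open>t w\<close> to
    \<open>w0\<close>.\<close>
  define q where "q = w0 - B *v z0"
  have nonneg: "0 \<le> \<bar>a\<bar> + t * a" if "t \<in> {0..1}" for a t :: real
  proof -
    have "\<bar>t * a\<bar> \<le> \<bar>a\<bar>"
      using that by (simp add: abs_mult mult_left_le_one_le)
    then show ?thesis by linarith
  qed
  have "w0 + t *\<^sub>R w \<in> LCP_omega_solutions q B" if t: "t \<in> {0..1}" for t
    unfolding LCP_omega_solutions_def
  proof (intro CollectI exI[of _ "z0 + t *\<^sub>R z"] conjI allI)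
    show "w0 + t *\<^sub>R w = B *v (z0 + t *\<^sub>R z) + q"
      by (simp add: q_def w_def matrix_vector_right_distrib matrix_vector_mult_scaleR)
    fix i
    show "0 \<le> (z0 + t *\<^sub>R z) $ i" "0 \<le> (w0 + t *\<^sub>R w) $ i"
      using nonneg[OF t] by (simp_all add: z0_def w0_def)
    \<comment> \<open>One of \<open>z $ i\<close> and \<open>w $ i\<close> is zero, and then so is
      the corresponding factor, absolute value included.\<close>
    show "(z0 + t *\<^sub>R z) $ i * (w0 + t *\<^sub>R w) $ i = 0"
      using compl[rule_format, of i] by (auto simp: z0_def w0_def w_def)
  qed
  then have "(\<lambda>t. w0 + t *\<^sub>R w) ` {0..1} \<subseteq> LCP_omega_solutions q B"
    by blast
  then have "finite ((\<lambda>t. w0 + t *\<^sub>R w) ` {0..1})"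
    using assms finite_subset by blast
  moreover have "inj_on (\<lambda>t. w0 + t *\<^sub>R w) {0..1}"
    using nz by (auto simp: inj_on_def w_def)
  ultimately have "finite {0..1::real}"
    by (rule finite_imageD)
  then show False
    by (simp add: infinite_Icc)
qed

text \<open>Only constant index lists contribute, and the list repeating \<open>j\<close>
  contributes the majorization entry times a pure power of \<open>x $ j\<close>.\<close>

lemma tensor_apply_row_diagonal:
  fixes A :: "'n::finite tensor"
  assumes "m \<ge> 2" and "row_diagonal m A"
  shows "tensor_apply m A x = majorization_matrix m A *v (\<chi> j. x $ j ^ (m - 1))"
proof (rule vec_eq_iff[THEN iffD2], rule allI)
  fix i
  let ?f = "\<lambda>js. A (i # js) * (\<Prod>j\<leftarrow>js. x $ j)"
  let ?r = "replicate (m - 1) :: 'n \<Rightarrow> 'n list"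
  have fin: "finite {js :: 'n list. length js = m - 1}"
    using finite_lists_length_eq[of "UNIV :: 'n set"] by simp
  have zero: "?f js = 0" if "length js = m - 1" "js \<notin> range ?r" for js
  proof (rule ccontr)
    assume "?f js \<noteq> 0"
    then have "A (i # js) \<noteq> 0" by auto
    then have same: "\<forall>j\<in>set js. \<forall>k\<in>set js. j = k"
      using assms(2) that(1) unfolding row_diagonal_def by blast
    have "js \<noteq> []"
      using that(1) assms(1) by auto
    then have "\<forall>k\<in>set js. k = hd js"
      using same hd_in_set by blast
    then have "js = ?r (hd js)"
      using that(1) by (metis replicate_length_same)
    then show False
      using that(2) by blast
  qed
  have "tensor_apply m A x $ i = (\<Sum>js\<in>range ?r. ?f js)"
    unfolding tensor_apply_def vec_lambda_beta
  proof (rule sum.mono_neutral_right[OF fin])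
    show "range ?r \<subseteq> {js. length js = m - 1}"
      by auto
    show "\<forall>js\<in>{js. length js = m - 1} - range ?r. ?f js = 0"
      using zero by blast
  qed
  also have "\<dots> = (\<Sum>j\<in>UNIV. ?f (?r j))"
  proof (rule sum.reindex_cong[where l = ?r])
    \<comment> \<open>Here \<open>m - 1 > 0\<close> matters: \<open>replicate 0\<close> would send
      every index to the empty list.\<close>
    show "inj ?r"
      using assms(1) by (auto simp: inj_def)
  qed auto
  also have "\<dots> = (majorization_matrix m A *v (\<chi> j. x $ j ^ (m - 1))) $ i"
    by (simp add: majorization_matrix_def matrix_vector_mult_def prod_list_replicate)
  finally show "tensor_apply m A x $ i = \<dots>" .
qed

text \<open>Odd roots exist for all reals, negative ones included, and preserve sign.\<close>

lemma ex_odd_power_vec: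
  fixes y :: "real ^ 'n::finite"
  assumes "odd k"
  obtains x where "y = (\<chi> j. x $ j ^ k)"
    and "(\<forall>j. 0 \<le> y $ j) \<longrightarrow> (\<forall>j. 0 \<le> x $ j)"
proof
  show "y = (\<chi> j. (\<chi> i. root k (y $ i)) $ j ^ k)"
    using assms by (simp add: vec_eq_iff odd_real_root_pow)
qed (use assms in \<open>simp add: odd_pos\<close>)

lemma column_competent_tensor_row_diagonal_iff:
  fixes A :: "'n::finite tensor"
  assumes "m \<ge> 2" and "even m" and "row_diagonal m A"
  shows "column_competent_tensor m A \<longleftrightarrow> column_competent_matrix (majorization_matrix m A)"
proof -
  have odd: "odd (m - 1)" using assms(1,2) by simp
  then have pos: "m - 1 > 0" by (rule odd_pos)
  let ?p = "\<lambda>x :: real ^ 'n. \<chi> j. x $ j ^ (m - 1)"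
  let ?M = "majorization_matrix m A"
  note apply_eq = tensor_apply_row_diagonal[OF assms(1,3)]
  \<comment> \<open>A positive power has the same zeros as its base.\<close>
  have iff: "x $ i * c = 0 \<longleftrightarrow> ?p x $ i * c = 0" for x i c
    using pos by simp
  show ?thesis
  proof
    assume tens: "column_competent_tensor m A"
    show "column_competent_matrix ?M"
      unfolding column_competent_matrix_def
    proof (intro allI impI)
      fix z
      assume z: "\<forall>i. z $ i * (?M *v z) $ i = 0"
      obtain x where "z = ?p x"
        using ex_odd_power_vec[OF odd] by blast
      then have "\<forall>i. x $ i * tensor_apply m A x $ i = 0"
        unfolding apply_eq using z iff by metis
      then have "tensor_apply m A x = 0"
        using tens unfolding column_competent_tensor_def by blast
      then show "?M *v z = 0"
        unfolding apply_eq \<open>z = ?p x\<close> .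
    qed
  next
    assume mat: "column_competent_matrix ?M"
    show "column_competent_tensor m A"
      unfolding column_competent_tensor_def apply_eq
    proof (intro allI impI)
      fix x
      assume "\<forall>i. x $ i * (?M *v ?p x) $ i = 0"
      then have "\<forall>i. ?p x $ i * (?M *v ?p x) $ i = 0"
        using iff by blast
      then show "?M *v ?p x = 0"
        using mat unfolding column_competent_matrix_def by blast
    qed
  qed
qed

lemma omega_solutions_row_diagonal:
  fixes A :: "'n::finite tensor"
  assumes "m \<ge> 2" and "even m" and "row_diagonal m A"
  shows "omega_solutions m q A = LCP_omega_solutions q (majorization_matrix m A)"
proof -
  have odd: "odd (m - 1)" using assms(1,2) by simp
  then have pos: "m - 1 > 0" by (rule odd_pos)
  let ?p = "\<lambda>x :: real ^ 'n. \<chi> j. x $ j ^ (m - 1)"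
  let ?M = "majorization_matrix m A"
  let ?L = "\<lambda>w z. (\<forall>i. 0 \<le> z $ i) \<and> w = ?M *v z + q \<and> (\<forall>i. 0 \<le> w $ i) \<and>
    (\<forall>i. z $ i * w $ i = 0)"
  \<comment> \<open>A sum of nonnegative products vanishes only termwise, and then each
    \<open>x $ i\<close> may be traded for its power.\<close>
  have inner_zero: "x \<bullet> w = 0 \<longleftrightarrow> (\<forall>i. ?p x $ i * w $ i = 0)"
    if "\<forall>i. 0 \<le> x $ i" "\<forall>i. 0 \<le> w $ i" for x w :: "real ^ 'n"
    using that pos unfolding inner_vec_def by (subst sum_nonneg_eq_0_iff) auto
  have TCP_L: "?L w (?p x)" if "TCP_solution m q A w x" for w x
    using that inner_zero
    unfolding TCP_solution_def tensor_apply_row_diagonal[OF assms(1,3)] by auto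
  have L_TCP: "\<exists>x. TCP_solution m q A w x" if "?L w z" for w z
  proof -
    obtain x where z: "z = ?p x" and "(\<forall>j. 0 \<le> z $ j) \<longrightarrow> (\<forall>j. 0 \<le> x $ j)"
      by (rule ex_odd_power_vec[OF odd])
    then have x: "\<forall>j. 0 \<le> x $ j"
      using that by blast
    have "x \<bullet> w = 0"
      using inner_zero[OF x] that unfolding z by blast
    then have "TCP_solution m q A w x"
      unfolding TCP_solution_def tensor_apply_row_diagonal[OF assms(1,3)]
      using x that unfolding z by blast
    then show ?thesis ..
  qed
  show ?thesis
    unfolding omega_solutions_def LCP_omega_solutions_def using TCP_L L_TCP by blast
qed

theorem theorem3p11:
  fixes A :: "'n::finite tensor" and m :: nat
  assumes "m \<ge> 2" and "even m" and "row_diagonal m A"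
  shows "(column_competent_matrix (majorization_matrix m A) \<longleftrightarrow> column_competent_tensor m A) \<and>
         (column_competent_tensor m A \<longleftrightarrow> (\<forall>q :: real ^ 'n. finite (omega_solutions m q A)))"
  unfolding column_competent_tensor_row_diagonal_iff[OF assms]
    omega_solutions_row_diagonal[OF assms]
  using finite_LCP_omega_solutions column_competent_matrix_if_finite_LCP_omega_solutions
  by blast

end
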